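(* Let $a,b\in\mathbb{C}$. (1) If ($a\neq 1$ and $a\neq 2$) or $b\neq 0$, then any central extension of $TSV(a,b)$ by a one-dimensional center $\mathbb{C}\mathfrak{c}$ is of the form $\widetilde{TSV(a,b)}=TSV(a,b)\oplus\mathbb{C}\mathfrak{c}$ with non-trivial $\lambda$-brackets $$[L_\lambda L]=(\partial+2\lambda)L+(A\lambda+B\lambda^3)\mathfrak{c},$$ $$[L_\lambda Y]=(\partial+a\lambda+b)Y+(C+D\lambda)\mathfrak{c},$$ $$[Y_\lambda Y]=(\partial+2\lambda)M+E\lambda\,\mathfrak{c},$$ $$[L_\lambda M]=(\partial+2(a-1)\lambda+2b)M+(bE+(a-1)E\lambda)\mathfrak{c},$$ where $A,B,C,D,E\in\mathbb{C}$ and $aC=bD$. (2) If $a=2$ and $b=0$, then any central extension of $TSV(2,0)$ by a one-dimensional center $\mathbb{C}\mathfrak{c}$ is of the form $\widetilde{TSV(2,0)}=TSV(2,0)\oplus\mathbb{C}\mathfrak{c}$ with non-trivial $\lambda$-brackets $$[L_\lambda L]=(\partial+2\lambda)L+(A\lambda+B\lambda^3)\mathfrak{c},$$ $$[L_\lambda Y]=(\partial+2\lambda)Y+(C\lambda+D\lambda^3)\mathfrak{c},$$ $$[Y_\lambda Y]=(\partial+2\lambda)M+(E\lambda+F\lambda^3)\mathfrak{c},$$ $$[L_\lambda M]=(\partial+2\lambda)M+(E\lambda+F\lambda^3)\mathfrak{c},$$ where $A,B,C,D,E,F\in\mathbb{C}$. (3) If $a=1$ and $b=0$, then any central extension of $TSV(1,0)$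 by a one-dimensional center $\mathbb{C}\mathfrak{c}$ is of the form $\widetilde{TSV(1,0)}=TSV(1,0)\oplus\mathbb{C}\mathfrak{c}$ with non-trivial $\lambda$-brackets $$[L_\lambda L]=(\partial+2\lambda)L+(A\lambda+B\lambda^3)\mathfrak{c},$$ $$[L_\lambda Y]=(\partial+\lambda)Y+(C\lambda+D\lambda^2)\mathfrak{c},\qquad [L_\lambda M]=\partial M,$$ $$[Y_\lambda Y]=(\partial+2\lambda)M+E\lambda\,\mathfrak{c},\qquad [Y_\lambda M]=F\mathfrak{c},$$ where $A,B,C,D,E,F\in\mathbb{C}$.
   Context: A Lie conformal algebra $R$ is a $\mathbb{C}[\partial]$-module with a $\mathbb{C}$-bilinear $\lambda$-bracket $[\cdot_\lambda\cdot]:R\otimes R\to R[\lambda]$ such that for all $a,b,c\in R$: $[\partial a_\lambda b]=-\lambda[a_\lambda b]$, $[a_\lambda\partial b]=(\lambda+\partial)[a_\lambda b]$; $[a_\lambda b]=-[b_{-\lambda-\partial}a]$ (skew-symmetry); $[a_\lambda[b_\mu c]]=[[a_\lambda b]_{\lambda+\mu}c]+[b_\mu[a_\lambda c]]$ (Jacobi identity). For $a,b\in\mathbb{C}$, $TSV(a,b)=\mathbb{C}[\partial]L\oplus\mathbb{C}[\partial]M\oplus\mathbb{C}[\partial]Y$ is the Lie conformal algebra, free over $\mathbb{C}[\partial]$ with basis $L,M,Y$, with $\lambda$-brackets $$[L_\lambda L]=(\partial+2\lambda)L,\quad [L_\lambda Y]=(\partial+a\lambda+b)Y,\quad [L_\lambda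 M]=(\partial+2(a-1)\lambda+2b)M,$$ $$[Y_\lambda Y]=(\partial+2\lambda)M,\quad [Y_\lambda M]=[M_\lambda M]=0,$$ the remaining brackets of basis elements being determined by skew-symmetry. A central extension of a Lie conformal algebra $R$ by a one-dimensional center $\mathbb{C}\mathfrak{c}$ is a Lie conformal algebra $\widehat R=R\oplus\mathbb{C}\mathfrak{c}$ (direct sum of $\mathbb{C}[\partial]$-modules) with $\partial\mathfrak{c}=0$, $[\mathfrak{c}_\lambda\widehat R]=0$, and $[a_\lambda b]_{\widehat R}=[a_\lambda b]_R+\alpha_\lambda(a,b)\mathfrak{c}$ for all $a,b\in R$, where $\alpha_\lambda:R\times R\to\mathbb{C}[\lambda]$ is a $\mathbb{C}$-bilinear map. "Non-trivial $\lambda$-brackets" means: every bracket of two elements of $\{L,Y,M,\mathfrak{c}\}$ that is neither listed nor obtained from a listed one by skew-symmetry is zero. *)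

theory Defs
  imports
    "HOL-Computational_Algebra.Polynomial"
    "HOL-Library.Product_Plus"
    Complex_Main
begin

section \<open>Lie conformal algebras\<close>

text \<open>
  A \<open>\<complex>[\<partial>]\<close>-module is a \<^locale>\<open>module\<close> over \<^typ>\<open>complex poly\<close> with
  action \<open>act\<close>; \<open>\<partial>\<close> acts as \<open>act [:0, 1:]\<close> and a scalar \<open>k\<close> as \<open>act [:k:]\<close>.  For a module on the
  type \<open>'r\<close>, the space \<open>R[\<lambda>]\<close> is \<open>'r poly\<close>, and \<open>R[\<lambda>,\<mu>]\<close> is \<open>'r poly poly\<close> with inner
  variable \<open>\<lambda>\<close> and outer variable \<open>\<mu>\<close>.
\<close>

definition c_bilinear ::
  "(complex \<Rightarrow> 'r \<Rightarrow> 'r) \<Rightarrow> (complex \<Rightarrow> 'p \<Rightarrow> 'p) \<Rightarrow> ('r::ab_group_add \<Rightarrow> 'r \<Rightarrow> 'p::ab_group_add) \<Rightarrow> bool"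
  where "c_bilinear s t f \<longleftrightarrow>
    (\<forall>y. Vector_Spaces.linear s t (\<lambda>x. f x y)) \<and> (\<forall>x. Vector_Spaces.linear s t (f x))"

text \<open>Substitution of an operator for the variable: a polynomial with coefficients \<open>r\<^sub>n\<close> is sent to
  the sum of the \<open>T\<^sup>n (f r\<^sub>n)\<close>, where \<open>f\<close> embeds the coefficients into the target.\<close>

definition subst_op :: "('n \<Rightarrow> 'n) \<Rightarrow> ('r \<Rightarrow> 'n) \<Rightarrow> 'r::zero poly \<Rightarrow> 'n::comm_monoid_add"
  where "subst_op T f p = (\<Sum>n\<le>degree p. (T ^^ n) (f (coeff p n)))"

text \<open>Multiplication by \<open>\<lambda>\<close> and by \<open>\<mu>\<close> on \<open>R[\<lambda>,\<mu>]\<close>.\<close>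

definition mult_lam :: "'r::zero poly poly \<Rightarrow> 'r poly poly"
  where "mult_lam = map_poly (pCons 0)"

definition mult_mu :: "'r::zero poly poly \<Rightarrow> 'r poly poly"
  where "mult_mu = pCons 0"

text \<open>\<open>bracket_at br T x y\<close> is \<open>[x\<^sub>T y]\<close> in \<open>R[\<lambda>,\<mu>]\<close>, where \<open>T\<close> is multiplication by an element
  of \<open>\<complex>[\<lambda>,\<mu>]\<close>.\<close>

definition bracket_at ::
  "('r \<Rightarrow> 'r \<Rightarrow> 'r poly) \<Rightarrow> ('r poly poly \<Rightarrow> 'r poly poly) \<Rightarrow> 'r \<Rightarrow> 'r \<Rightarrow> 'r::ab_group_add poly poly"
  where "bracket_at br T x y = subst_op T (\<lambda>r. [:[:r:]:]) (br x y)"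

locale lie_conformal_algebra = module act
  for act :: "complex poly \<Rightarrow> 'r::ab_group_add \<Rightarrow> 'r" +
  fixes br :: "'r \<Rightarrow> 'r \<Rightarrow> 'r poly"
  assumes bilinear: "c_bilinear (\<lambda>k. act [:k:]) (\<lambda>k. map_poly (act [:k:])) br"
    and sesquilinear_left: "br (act [:0, 1:] x) y = - pCons 0 (br x y)"
    and sesquilinear_right:
      "br x (act [:0, 1:] y) = pCons 0 (br x y) + map_poly (act [:0, 1:]) (br x y)"
    \<comment> \<open>\<open>[x\<^sub>\<lambda> y] = - [y\<^sub>T x]\<close> with \<open>T = - \<lambda> - \<partial>\<close>\<close>
    and skew_symmetry:
      "br x y = - subst_op (\<lambda>q. - pCons 0 q - map_poly (act [:0, 1:]) q) (\<lambda>r. [:r:]) (br y x)"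
    \<comment> \<open>\<open>[x\<^sub>\<lambda> [y\<^sub>\<mu> z]] = [[x\<^sub>\<lambda> y]\<^sub>T z] + [y\<^sub>\<mu> [x\<^sub>\<lambda> z]]\<close> with \<open>T = \<lambda> + \<mu>\<close>\<close>
    and jacobi:
      "subst_op mult_mu (bracket_at br mult_lam x) (br y z) =
       subst_op mult_lam (\<lambda>r. bracket_at br (\<lambda>q. mult_lam q + mult_mu q) r z) (br x y) +
       subst_op mult_lam (bracket_at br mult_mu y) (br x z)"

section \<open>Central extensions by a one-dimensional center\<close>

text \<open>The module \<open>R \<oplus> \<complex>\<cc>\<close> is \<open>'r \<times> complex\<close> with \<open>\<cc> = (0, 1)\<close>; since \<open>\<partial>\<cc> = 0\<close>, a polynomial in
  \<open>\<partial>\<close> acts on \<open>\<complex>\<cc>\<close> through its constant term.\<close>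

definition ext_act :: "(complex poly \<Rightarrow> 'r \<Rightarrow> 'r) \<Rightarrow> complex poly \<Rightarrow> 'r \<times> complex \<Rightarrow> 'r \<times> complex"
  where "ext_act act p x = (act p (fst x), coeff p 0 * snd x)"

definition central_extension ::
  "(complex poly \<Rightarrow> 'r \<Rightarrow> 'r) \<Rightarrow> ('r \<Rightarrow> 'r \<Rightarrow> 'r poly) \<Rightarrow>
   ('r \<times> complex \<Rightarrow> 'r \<times> complex \<Rightarrow> ('r::ab_group_add \<times> complex) poly) \<Rightarrow> bool"
  where "central_extension act br br' \<longleftrightarrow>
    lie_conformal_algebra (ext_act act) br' \<and>
    (\<forall>x. br' (0, 1) x = 0) \<and>
    (\<exists>\<alpha> :: 'r \<Rightarrow> 'r \<Rightarrow> complex poly.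
      c_bilinear (\<lambda>k. act [:k:]) smult \<alpha> \<and>
      (\<forall>x y. br' (x, 0) (y, 0) =
        map_poly (\<lambda>r. (r, 0)) (br x y) + map_poly (\<lambda>z. (0, z)) (\<alpha> x y)))"

section \<open>The Lie conformal algebra \<open>TSV(a,b)\<close>\<close>

text \<open>\<open>\<complex>[\<partial>,\<lambda>]\<close> is \<^typ>\<open>complex poly poly\<close> with inner variable \<open>\<partial>\<close> and outer variable \<open>\<lambda>\<close>.\<close>

abbreviation dd :: "complex poly poly" ("\<partial>") where "\<partial> \<equiv> [:[:0, 1:]:]"
abbreviation lam :: "complex poly poly" where "lam \<equiv> [:0, 1:]"
abbreviation cst :: "complex \<Rightarrow> complex poly poly" where "cst k \<equiv> [:[:k:]:]"

definition lam_act :: "(complex poly \<Rightarrow> 'r \<Rightarrow> 'r) \<Rightarrow> complex poly poly \<Rightarrow> 'r \<Rightarrow> 'r::zero poly"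
  where "lam_act act P x = map_poly (\<lambda>p. act p x) P"

type_synonym tsv = "complex poly \<times> complex poly \<times> complex poly"

definition tsv_act :: "complex poly \<Rightarrow> tsv \<Rightarrow> tsv"
  where "tsv_act p x = (p * fst x, p * fst (snd x), p * snd (snd x))"

definition tsv_L :: tsv where "tsv_L = (1, 0, 0)"
definition tsv_M :: tsv where "tsv_M = (0, 1, 0)"
definition tsv_Y :: tsv where "tsv_Y = (0, 0, 1)"

text \<open>\<open>p(\<partial>)\<close> gives \<open>p(-\<lambda>)\<close> in the left argument of a bracket and \<open>p(\<partial>+\<lambda>)\<close> in the right one.\<close>

definition left_arg :: "complex poly \<Rightarrow> complex poly poly"
  where "left_arg p = pcompose (map_poly (\<lambda>k. [:k:]) p) (- lam)"

definition right_arg :: "complex poly \<Rightarrow> complex poly poly"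
  where "right_arg p = pcompose (map_poly (\<lambda>k. [:k:]) p) (\<partial> + lam)"

text \<open>If \<open>[x\<^sub>\<lambda> y] = P(\<partial>,\<lambda>) z\<close>, then \<open>[y\<^sub>\<lambda> x] = - P(\<partial>,-\<lambda>-\<partial>) z\<close>.\<close>

definition skew :: "complex poly poly \<Rightarrow> complex poly poly"
  where "skew P = - pcompose P (- lam - \<partial>)"

fun tsv_bracket :: "complex \<Rightarrow> complex \<Rightarrow> tsv \<Rightarrow> tsv \<Rightarrow> tsv poly"
  where "tsv_bracket a b (l, m, y) (l', m', y') =
   (let LL = \<partial> + 2 * lam;
        LY = \<partial> + cst a * lam + cst b;
        LM = \<partial> + cst (2 * (a - 1)) * lam + cst (2 * b);
        YY = \<partial> + 2 * lam
    in lam_act tsv_act (left_arg l * right_arg l' * LL) tsv_L +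
       lam_act tsv_act (left_arg l * right_arg y' * LY + left_arg y * right_arg l' * skew LY) tsv_Y +
       lam_act tsv_act (left_arg l * right_arg m' * LM + left_arg m * right_arg l' * skew LM
         + left_arg y * right_arg y' * YY) tsv_M)"

text \<open>\<open>T\<close> lists the brackets \<open>[x\<^sub>\<lambda> y] = p\<close> as triples \<open>(x, y, p)\<close>; the brackets of elements of \<open>S\<close>
  that are neither listed nor the transpose of a listed one vanish.\<close>

definition nontrivial_brackets ::
  "('r \<Rightarrow> 'r \<Rightarrow> 'r::zero poly) \<Rightarrow> 'r set \<Rightarrow> ('r \<times> 'r \<times> 'r poly) set \<Rightarrow> bool"
  where "nontrivial_brackets br S T \<longleftrightarrow>
    (\<forall>(x, y, p) \<in> T. br x y = p) \<and>
    (\<forall>x\<in>S. \<forall>y\<in>S. (\<nexists>p. (x, y, p) \<in> T \<or> (y, x, p) \<in> T) \<longrightarrow> br x y = 0)"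

text \<open>The generators of \<open>TSV(a,b) \<oplus> \<complex>\<cc>\<close> and its elements \<open>P(\<partial>,\<lambda>) x\<close>.\<close>

abbreviation ext_L ("\<L>") where "\<L> \<equiv> (tsv_L, 0 :: complex)"
abbreviation ext_M ("\<M>") where "\<M> \<equiv> (tsv_M, 0 :: complex)"
abbreviation ext_Y ("\<Y>") where "\<Y> \<equiv> (tsv_Y, 0 :: complex)"
abbreviation ext_c ("\<cc>") where "\<cc> \<equiv> (0 :: tsv, 1 :: complex)"

abbreviation ext_lam_act :: "complex poly poly \<Rightarrow> tsv \<times> complex \<Rightarrow> (tsv \<times> complex) poly" (infixr "\<odot>" 75)
  where "P \<odot> x \<equiv> lam_act (ext_act tsv_act) P x"

section \<open>\<open>TSV(a,b)\<close> is a Lie conformal algebra\<close>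

text \<open>Identities in \<open>R[\<lambda>]\<close> and \<open>R[\<lambda>,\<mu>]\<close> are checked by evaluating coordinates at complex numbers.\<close>

definition ev_at :: "('r::ab_group_add \<Rightarrow> complex) \<Rightarrow> complex \<Rightarrow> 'r poly \<Rightarrow> complex"
  where "ev_at \<phi> x p = (\<Sum>n\<le>degree p. \<phi> (coeff p n) * x ^ n)"

lemma ev_at_upto:
  assumes "additive \<phi>" "degree p \<le> N"
  shows "ev_at \<phi> x p = (\<Sum>n\<le>N. \<phi> (coeff p n) * x ^ n)"
proof -
  have "(\<Sum>n\<le>N. \<phi> (coeff p n) * x ^ n) = (\<Sum>n\<le>degree p. \<phi> (coeff p n) * x ^ n)"
    using assms by (intro sum.mono_neutral_right) (auto simp: coeff_eq_0 additive.zero)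
  thus ?thesis by (simp add: ev_at_def)
qed

lemma ev_at_additive: assumes "additive \<phi>" shows "additive (ev_at \<phi> x)"
proof
  fix p q :: "'a poly"
  define N where "N = max (degree p) (degree q)"
  have "degree (p + q) \<le> N" "degree p \<le> N" "degree q \<le> N"
    unfolding N_def by (auto intro: degree_add_le_max)
  thus "ev_at \<phi> x (p + q) = ev_at \<phi> x p + ev_at \<phi> x q"
    using assms by (simp add: ev_at_upto additive.add sum.distrib algebra_simps)
qed

lemma ev_at_pCons: assumes "additive \<phi>" shows "ev_at \<phi> x (pCons r p) = \<phi> r + x * ev_at \<phi> x p"
proof -
  have "degree (pCons r p) \<le> Suc (degree p)" by (rule degree_pCons_le)
  hence "ev_at \<phi> x (pCons r p) = (\<Sum>n\<le>Suc (degree p). \<phi> (coeff (pCons r p) n) * x ^ n)"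
    using assms by (simp add: ev_at_upto)
  also have "\<dots> = \<phi> r + x * (\<Sum>n\<le>degree p. \<phi> (coeff p n) * x ^ n)"
    by (simp add: sum.atMost_Suc_shift sum_distrib_left algebra_simps del: sum.atMost_Suc)
  finally show ?thesis by (simp add: ev_at_def)
qed

lemma ev_at_0: "additive \<phi> \<Longrightarrow> ev_at \<phi> x 0 = 0" by (simp add: additive.zero ev_at_additive)

lemma ev_at_map_poly:
  assumes "additive (\<lambda>r. \<phi> (f r))" "f 0 = 0" "additive \<phi>"
  shows "ev_at \<phi> x (map_poly f p) = ev_at (\<lambda>r. \<phi> (f r)) x p"
proof -
  have "degree (map_poly f p) \<le> degree p" by (rule map_poly_degree_leq)
  from ev_at_upto[OF assms(3) this] show ?thesis using assms by (simp add: ev_at_def coeff_map_poly)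
qed

lemma ev_at_eqI:
  assumes "\<And>\<phi>. \<phi> \<in> \<Phi> \<Longrightarrow> additive \<phi>" "\<And>r. (\<And>\<phi>. \<phi> \<in> \<Phi> \<Longrightarrow> \<phi> r = 0) \<Longrightarrow> r = (0::'r::ab_group_add)"
    and "\<And>\<phi> x. \<phi> \<in> \<Phi> \<Longrightarrow> ev_at \<phi> x p = 0"
  shows "p = 0"
proof (rule poly_eqI)
  fix n
  have "\<phi> (coeff p n) = 0" if "\<phi> \<in> \<Phi>" for \<phi>
  proof -
    note a = assms(1)[OF that]
    have "poly (map_poly \<phi> p) x = 0" for x
    proof -
      have "degree (map_poly \<phi> p) \<le> degree p" by (rule map_poly_degree_leq)
      hence "poly (map_poly \<phi> p) x = (\<Sum>n\<le>degree p. coeff (map_poly \<phi> p) n * x ^ n)"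
        unfolding poly_altdef by (intro sum.mono_neutral_left) (auto simp: coeff_eq_0)
      also have "\<dots> = ev_at \<phi> x p" using a by (simp add: ev_at_def coeff_map_poly additive.zero)
      finally show ?thesis using assms(3)[OF that] by simp
    qed
    hence "map_poly \<phi> p = 0" using poly_all_0_iff_0 by blast
    thus ?thesis using a by (metis coeff_0 coeff_map_poly additive.zero)
  qed
  thus "coeff p n = coeff 0 n" using assms(2) by simp
qed

lemma subst_op_eval:
  assumes "additive E" "\<And>q. E (T q) = t * E q"
  shows "E (subst_op T f p) = ev_at (\<lambda>r. E (f r)) t p"
proof -
  have "E ((T ^^ n) q) = t ^ n * E q" for n q by (induction n) (auto simp: assms)
  thus ?thesis unfolding subst_op_def ev_at_def
    by (simp add: additive.sum[OF assms(1)] mult.commute)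
qed

abbreviation ev_at2 where "ev_at2 \<phi> x y \<equiv> ev_at (ev_at \<phi> x) y"

lemma ev_at2_mu: "additive \<phi> \<Longrightarrow> ev_at2 \<phi> x y (mult_mu q) = y * ev_at2 \<phi> x y q"
  by (simp add: mult_mu_def ev_at_pCons ev_at_additive ev_at_0)
lemma ev_at_scale: "ev_at (\<lambda>r. c * \<phi> r) y q = c * ev_at \<phi> y q"
  by (simp add: ev_at_def sum_distrib_left mult.assoc)
lemma ev_at_plus: "ev_at (\<lambda>r. \<phi> r + \<psi> r) y q = ev_at \<phi> y q + ev_at \<psi> y q"
  by (simp add: ev_at_def sum.distrib algebra_simps)
lemma ev_at2_lam: "additive \<phi> \<Longrightarrow> ev_at2 \<phi> x y (mult_lam q) = x * ev_at2 \<phi> x y q"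
  unfolding mult_lam_def
  by (subst ev_at_map_poly) (auto simp: ev_at_pCons ev_at_additive ev_at_0 ev_at_scale additive.zero intro!: additive.intro,
    simp add: ev_at_additive additive.add distrib_left)

lemma ev_at2_bracket_at:
  assumes "additive \<phi>" "\<And>q. ev_at2 \<phi> x y (T q) = t * ev_at2 \<phi> x y q"
  shows "ev_at2 \<phi> x y (bracket_at br T u v) = ev_at \<phi> t (br u v)"
  unfolding bracket_at_def using assms
  by (subst subst_op_eval[where t=t]) (simp_all add: ev_at_additive ev_at_pCons ev_at_0)

definition ev2 :: "complex \<Rightarrow> complex \<Rightarrow> complex poly poly \<Rightarrow> complex"
  where "ev2 d x P = poly (poly P [:x:]) d"

lemma ev2_simps [simp]:
  "ev2 d x (P + Q) = ev2 d x P + ev2 d x Q" "ev2 d x (P * Q) = ev2 d x P * ev2 d x Q"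
  "ev2 d x (- P) = - ev2 d x P" "ev2 d x (P - Q) = ev2 d x P - ev2 d x Q"
  "ev2 d x lam = x" "ev2 d x \<partial> = d" "ev2 d x (cst k) = k" "ev2 d x 2 = 2" "ev2 d x (numeral w) = numeral w"
  by (auto simp: ev2_def numeral_poly)

lemma ev2_pcompose: "ev2 d x (pcompose P Q) = poly (poly P (poly Q [:x:])) d"
  by (simp add: ev2_def poly_pcompose)

lemma poly_map_const: "poly (poly (map_poly (\<lambda>k. [:k:]) p) r) d = poly p (poly r d)"
  by (induction p) (auto simp: map_poly_pCons)

lemma ev2_left [simp]: "ev2 d x (left_arg p) = poly p (-x)"
  by (simp add: left_arg_def ev2_pcompose poly_map_const)
lemma ev2_right [simp]: "ev2 d x (right_arg p) = poly p (d + x)"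
  by (simp add: right_arg_def ev2_pcompose poly_map_const add.commute)
lemma poly_poly_ev: "poly (poly P r) d = ev2 d (poly r d) P"
  by (induction P) (auto simp: ev2_def)
lemma ev2_skew [simp]: "ev2 d x (skew P) = - ev2 d (- x - d) P"
  by (simp add: skew_def ev2_pcompose poly_poly_ev)

definition "coord_L d u = poly (fst (u::tsv)) d"
definition "coord_M d u = poly (fst (snd (u::tsv))) d"
definition "coord_Y d u = poly (snd (snd (u::tsv))) d"

lemmas coord_defs = coord_L_def coord_M_def coord_Y_def
lemma coord_additive [simp]: "additive (coord_L d)" "additive (coord_M d)" "additive (coord_Y d)"
  by (auto simp: additive_def coord_defs)

lemma ev_at_ev2: "ev_at (\<lambda>r. poly r d) x P = ev2 d x P"
  by (induction P) (auto simp: ev_at_0 ev_at_pCons additive_def ev2_def)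

lemma lam_act_eval:
  "ev_at (coord_L d) x (lam_act tsv_act P u) = ev2 d x P * coord_L d u"
  "ev_at (coord_M d) x (lam_act tsv_act P u) = ev2 d x P * coord_M d u"
  "ev_at (coord_Y d) x (lam_act tsv_act P u) = ev2 d x P * coord_Y d u"
proof -
  have *: "ev_at (\<lambda>r. poly r d * c) x P = ev2 d x P * c" for c
    using ev_at_scale[of c "\<lambda>r. poly r d" x P] by (simp add: ev_at_ev2 mult.commute)
  show "ev_at (coord_L d) x (lam_act tsv_act P u) = ev2 d x P * coord_L d u"
    "ev_at (coord_M d) x (lam_act tsv_act P u) = ev2 d x P * coord_M d u"
    "ev_at (coord_Y d) x (lam_act tsv_act P u) = ev2 d x P * coord_Y d u"
    unfolding lam_act_def
    by (subst ev_at_map_poly; simp add: coord_defs tsv_act_def * additive_def algebra_simps zero_prod_def)+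
qed

lemma basis_eval [simp]: "coord_L d tsv_L = 1" "coord_M d tsv_L = 0" "coord_Y d tsv_L = 0"
  "coord_L d tsv_M = 0" "coord_M d tsv_M = 1" "coord_Y d tsv_M = 0"
  "coord_L d tsv_Y = 0" "coord_M d tsv_Y = 0" "coord_Y d tsv_Y = 1"
  by (simp_all add: coord_defs tsv_L_def tsv_M_def tsv_Y_def)

lemma bracket_eval:
  "ev_at (coord_L d) x (tsv_bracket a b u v) = coord_L (-x) u * coord_L (d+x) v * (d + 2*x)"
  "ev_at (coord_Y d) x (tsv_bracket a b u v) = coord_L (-x) u * coord_Y (d+x) v * (d + a*x+b)
      + coord_Y (-x) u * coord_L (d+x) v * (-(d+a*(-x-d)+b))"
  "ev_at (coord_M d) x (tsv_bracket a b u v) = coord_L (-x) u * coord_M (d+x) v * (d + 2*(a-1)*x+2*b)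
      + coord_M (-x) u * coord_L (d+x) v * (-(d+2*(a-1)*(-x-d)+2*b)) + coord_Y (-x) u * coord_Y (d+x) v * (d+2*x)"
  by (cases u; cases v; simp only: tsv_bracket.simps Let_def ev_at_additive coord_additive additive.add lam_act_eval
      ev2_simps ev2_left ev2_right ev2_skew basis_eval; simp add: coord_defs)+

lemma ev_at_uminus: "additive \<phi> \<Longrightarrow> ev_at \<phi> x (- p) = - ev_at \<phi> x p"
  by (simp add: ev_at_additive additive.minus)
lemma ev_at_padd: "additive \<phi> \<Longrightarrow> ev_at \<phi> x (p + q) = ev_at \<phi> x p + ev_at \<phi> x q"
  by (simp add: ev_at_additive additive.add)
lemma ev_at_pdiff: "additive \<phi> \<Longrightarrow> ev_at \<phi> x (p - q) = ev_at \<phi> x p - ev_at \<phi> x q"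
  by (simp add: ev_at_additive additive.diff)

lemma tsv_eqI:
  assumes "\<And>d x. ev_at (coord_L d) x p = ev_at (coord_L d) x q" "\<And>d x. ev_at (coord_M d) x p = ev_at (coord_M d) x q"
   "\<And>d x. ev_at (coord_Y d) x p = ev_at (coord_Y d) x q"
 shows "p = q"
proof -
  let ?\<Phi> = "range coord_L \<union> range coord_M \<union> range coord_Y"
  have "p - q = 0"
  proof (rule ev_at_eqI[of ?\<Phi>])
    fix r assume r: "\<And>\<phi>. \<phi> \<in> ?\<Phi> \<Longrightarrow> \<phi> r = 0"
    have "coord_L d r = 0" "coord_M d r = 0" "coord_Y d r = 0" for d
      by (rule r, simp)+
    thus "r = 0" by (cases r) (simp add: coord_defs zero_prod_def poly_all_0_iff_0[symmetric])
  qed (use assms in \<open>auto simp: ev_at_additive ev_at_pdiff\<close>)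
  thus ?thesis by simp
qed

lemma tsv_eqI2:
  assumes "\<And>d x y. ev_at2 (coord_L d) x y p = ev_at2 (coord_L d) x y q" "\<And>d x y. ev_at2 (coord_M d) x y p = ev_at2 (coord_M d) x y q"
   "\<And>d x y. ev_at2 (coord_Y d) x y p = ev_at2 (coord_Y d) x y q"
 shows "p = q"
proof -
  let ?\<Phi> = "{ev_at (coord_L d) x|d x. True} \<union> {ev_at (coord_M d) x|d x. True} \<union> {ev_at (coord_Y d) x|d x. True}"
  have "p - q = 0"
  proof (rule ev_at_eqI[of ?\<Phi>])
    fix r assume r: "\<And>\<phi>. \<phi> \<in> ?\<Phi> \<Longrightarrow> \<phi> r = 0"
    have "ev_at (coord_L d) x r = 0" "ev_at (coord_M d) x r = 0" "ev_at (coord_Y d) x r = 0" for d x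
      by (rule r, blast)+
    thus "r = 0" by (intro tsv_eqI) (simp_all add: ev_at_0)
  qed (use assms in \<open>auto simp: ev_at_additive ev_at_pdiff\<close>)
  thus ?thesis by simp
qed

lemma tsv_bracket_basis:
  "tsv_bracket a b tsv_L tsv_L = lam_act tsv_act (\<partial> + 2 * lam) tsv_L"
  "tsv_bracket a b tsv_L tsv_Y = lam_act tsv_act (\<partial> + cst a * lam + cst b) tsv_Y"
  "tsv_bracket a b tsv_L tsv_M = lam_act tsv_act (\<partial> + cst (2 * (a - 1)) * lam + cst (2 * b)) tsv_M"
  "tsv_bracket a b tsv_Y tsv_Y = lam_act tsv_act (\<partial> + 2 * lam) tsv_M"
  "tsv_bracket a b tsv_Y tsv_M = 0"
  "tsv_bracket a b tsv_M tsv_M = 0"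
  by (rule tsv_eqI; simp only: bracket_eval basis_eval lam_act_eval ev2_simps ev_at_0 coord_additive; simp add: algebra_simps)+

lemma coord_act: "coord_L d (tsv_act p u) = poly p d * coord_L d u" "coord_M d (tsv_act p u) = poly p d * coord_M d u"
  "coord_Y d (tsv_act p u) = poly p d * coord_Y d u"
  by (auto simp: coord_defs tsv_act_def)

lemma ev_at_act: "ev_at (coord_L d) x (map_poly (tsv_act p) q) = poly p d * ev_at (coord_L d) x q"
  "ev_at (coord_M d) x (map_poly (tsv_act p) q) = poly p d * ev_at (coord_M d) x q"
  "ev_at (coord_Y d) x (map_poly (tsv_act p) q) = poly p d * ev_at (coord_Y d) x q"
proof -
  have z: "tsv_act p 0 = 0" by (simp add: tsv_act_def zero_prod_def)
  have ad: "additive (\<lambda>r. c * coord_L d r)" "additive (\<lambda>r. c * coord_M d r)" "additive (\<lambda>r. c * coord_Y d r)" for c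
    by (auto simp: additive_def coord_defs algebra_simps)
  show "ev_at (coord_L d) x (map_poly (tsv_act p) q) = poly p d * ev_at (coord_L d) x q"
    "ev_at (coord_M d) x (map_poly (tsv_act p) q) = poly p d * ev_at (coord_M d) x q"
    "ev_at (coord_Y d) x (map_poly (tsv_act p) q) = poly p d * ev_at (coord_Y d) x q"
    using ev_at_map_poly[of "coord_L d" "tsv_act p" x q] ev_at_map_poly[of "coord_M d" "tsv_act p" x q]
      ev_at_map_poly[of "coord_Y d" "tsv_act p" x q] by (simp_all add: coord_act ad ev_at_scale z)
qed

lemma module_tsv: "module tsv_act"
  by unfold_locales (auto simp: tsv_act_def algebra_simps)

lemmas ev_at_simps = ev_at_uminus ev_at_padd ev_at_pdiff ev_at_pCons ev_at_0 ev_at_additive ev_at_act bracket_eval coord_act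

lemma coord_add: "coord_L d (u+v) = coord_L d u + coord_L d v" "coord_M d (u+v) = coord_M d u + coord_M d v" "coord_Y d (u+v) = coord_Y d u + coord_Y d v"
  by (auto simp: coord_defs)

lemma tsv_bilinear: "c_bilinear (\<lambda>k. tsv_act [:k:]) (\<lambda>k. map_poly (tsv_act [:k:])) (tsv_bracket a b)"
proof -
  have v: "vector_space (\<lambda>k. tsv_act [:k:])"
    by unfold_locales (auto simp: tsv_act_def algebra_simps smult_add_left smult_add_right)
  have w: "vector_space (\<lambda>k. map_poly (tsv_act [:k:]))"
    by unfold_locales (rule tsv_eqI; simp add: ev_at_simps algebra_simps)+
  show ?thesis unfolding c_bilinear_def Vector_Spaces.linear_iff
    by (intro conjI allI v w; rule tsv_eqI; simp only: ev_at_simps coord_additive coord_add; simp add: algebra_simps)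
qed

lemma tsv_skew:
  "tsv_bracket a b u v = - subst_op (\<lambda>q. - pCons 0 q - map_poly (tsv_act [:0, 1:]) q) (\<lambda>r. [:r:]) (tsv_bracket a b v u)"
proof -
  have L: "ev_at (coord_L d) x (subst_op (\<lambda>q. - pCons 0 q - map_poly (tsv_act [:0, 1:]) q) (\<lambda>r. [:r:]) p)
    = ev_at (coord_L d) (-x-d) p" for d x p
    by (subst subst_op_eval[where t="-x-d"]) (auto simp: ev_at_simps coord_additive[THEN additive.zero] algebra_simps)
  have M: "ev_at (coord_M d) x (subst_op (\<lambda>q. - pCons 0 q - map_poly (tsv_act [:0, 1:]) q) (\<lambda>r. [:r:]) p)
    = ev_at (coord_M d) (-x-d) p" for d x p
    by (subst subst_op_eval[where t="-x-d"]) (auto simp: ev_at_simps coord_additive[THEN additive.zero] algebra_simps)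
  have Y: "ev_at (coord_Y d) x (subst_op (\<lambda>q. - pCons 0 q - map_poly (tsv_act [:0, 1:]) q) (\<lambda>r. [:r:]) p)
    = ev_at (coord_Y d) (-x-d) p" for d x p
    by (subst subst_op_eval[where t="-x-d"]) (auto simp: ev_at_simps coord_additive[THEN additive.zero] algebra_simps)
  show ?thesis by (rule tsv_eqI; simp only: ev_at_uminus coord_additive L M Y bracket_eval; simp add: algebra_simps)
qed

lemma subst_mu: "additive \<phi> \<Longrightarrow> ev_at2 \<phi> x y (subst_op mult_mu f p) = ev_at (\<lambda>r. ev_at2 \<phi> x y (f r)) y p"
  by (rule subst_op_eval) (auto simp: ev_at_additive ev_at2_mu)
lemma subst_lam: "additive \<phi> \<Longrightarrow> ev_at2 \<phi> x y (subst_op mult_lam f p) = ev_at (\<lambda>r. ev_at2 \<phi> x y (f r)) x p"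
  by (rule subst_op_eval) (auto simp: ev_at_additive ev_at2_lam)
lemma at_lam: "additive \<phi> \<Longrightarrow> ev_at2 \<phi> x y (bracket_at br mult_lam u v) = ev_at \<phi> x (br u v)"
  by (rule ev_at2_bracket_at) (auto simp: ev_at2_lam)
lemma at_mu: "additive \<phi> \<Longrightarrow> ev_at2 \<phi> x y (bracket_at br mult_mu u v) = ev_at \<phi> y (br u v)"
  by (rule ev_at2_bracket_at) (auto simp: ev_at2_mu)
lemma at_lam_mu: "additive \<phi> \<Longrightarrow>
   ev_at2 \<phi> x y (bracket_at br (\<lambda>q. mult_lam q + mult_mu q) u v) = ev_at \<phi> (x+y) (br u v)"
  by (rule ev_at2_bracket_at) (auto simp: ev_at2_mu ev_at2_lam ev_at_padd ev_at_additive distrib_right)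

lemma ev_at_scale2: "ev_at (\<lambda>r. \<phi> r * c) y q = ev_at \<phi> y q * c"
  by (simp add: ev_at_def sum_distrib_right sum_distrib_left algebra_simps)

lemma tsv_lie_conformal_algebra: "lie_conformal_algebra tsv_act (tsv_bracket a b)"
proof -
  interpret module tsv_act by (rule module_tsv)
  note S = subst_mu subst_lam at_lam at_mu at_lam_mu ev_at_padd ev_at_additive coord_additive bracket_eval ev_at_plus ev_at_scale ev_at_scale2
  show ?thesis
  proof unfold_locales
    fix x y z
    show "tsv_bracket a b (tsv_act [:0, 1:] x) y = - pCons 0 (tsv_bracket a b x y)"
      by (rule tsv_eqI) (simp_all add: ev_at_simps coord_additive[THEN additive.zero] algebra_simps)
    show "tsv_bracket a b x (tsv_act [:0, 1:] y) =
        pCons 0 (tsv_bracket a b x y) + map_poly (tsv_act [:0, 1:]) (tsv_bracket a b x y)"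
      by (rule tsv_eqI) (simp_all add: ev_at_simps coord_additive[THEN additive.zero] algebra_simps)
    show "subst_op mult_mu (bracket_at (tsv_bracket a b) mult_lam x) (tsv_bracket a b y z) =
       subst_op mult_lam (\<lambda>r. bracket_at (tsv_bracket a b) (\<lambda>q. mult_lam q + mult_mu q) r z) (tsv_bracket a b x y) +
       subst_op mult_lam (bracket_at (tsv_bracket a b) mult_mu y) (tsv_bracket a b x z)"
      by (rule tsv_eqI2; simp only: S; simp add: add_ac; algebra)
  qed (rule tsv_bilinear tsv_skew)+
qed

end

theory Submission
  imports Defs
begin

text \<open>
  Projecting the extended bracket to \<open>\<complex>\<cc>\<close> turns skew-symmetry and the Jacobi identity into functional
  equations for the polynomials \<open>\<alpha>\<^sub>\<lambda>(u,v)\<close> on the basis.  The triples \<open>LLv\<close> give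
  \<open>(\<lambda> + c\<mu> + e) p(\<lambda>) - (\<mu> + c\<lambda> + e) p(\<mu>) = (\<lambda> - \<mu>) p(\<lambda> + \<mu>)\<close> for \<open>p(\<lambda>) = \<alpha>\<^sub>\<lambda>(L,v)\<close>.  For
  \<open>e \<noteq> 0\<close>, \<open>\<mu> = 0\<close> makes \<open>p\<close> a multiple of \<open>c\<lambda> + e\<close>; for \<open>e = 0\<close>, the first two derivatives in
  \<open>\<mu>\<close> at \<open>0\<close> bound the degree by 3 and tie each coefficient other than the linear one to a single
  value of \<open>c\<close>.  The triple \<open>LYY\<close> at \<open>\<mu> = 0\<close> relates \<open>\<alpha>(L,M)\<close> to \<open>\<alpha>(Y,Y)\<close>, \<open>LYM\<close> determines
  \<open>\<alpha>(Y,M)\<close>, and \<open>YYM\<close> kills \<open>\<alpha>(M,M)\<close>.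
\<close>

section \<open>Cocycles of central extensions\<close>

text \<open>Covers functionals on which \<open>act p\<close> becomes the scalar p(d). It is applied
  to \<open>form s\<close> in either slot, with d = s on the right and d = -s on the left.\<close>

lemma ev_at_lam_act:
  assumes "additive \<phi>" "\<And>p r. \<phi> (act p r) = poly p d * \<phi> r" "act 0 z = 0"
  shows "ev_at \<phi> x (lam_act act P z) = ev2 d x P * \<phi> z"
proof -
  have ad: "additive (\<lambda>p. \<phi> (act p z))"
    using assms(2) by (auto simp: additive_def algebra_simps)
  have "ev_at \<phi> x (lam_act act P z) = ev_at (\<lambda>p. \<phi> (act p z)) x P"
    unfolding lam_act_def by (rule ev_at_map_poly[OF ad assms(3,1)])
  also have "\<dots> = ev_at (\<lambda>p. \<phi> z * poly p d) x P"
    by (simp add: assms(2) mult.commute)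
  finally show ?thesis by (simp add: ev_at_scale ev_at_ev2)
qed

text \<open>A functional that annihilates the image of \<open>\<partial>\<close> turns the axioms into scalar identities:
  \<open>\<partial>\<close> then acts as \<open>-x\<close> on the left and as \<open>x\<close> on the right argument of \<open>\<phi> [u\<^sub>x v]\<close>.\<close>

locale lie_conformal_functional = lie_conformal_algebra act br
  for act :: "complex poly \<Rightarrow> 'r::ab_group_add \<Rightarrow> 'r" and br :: "'r \<Rightarrow> 'r \<Rightarrow> 'r poly" +
  fixes \<phi> :: "'r \<Rightarrow> complex"
  assumes additive: "additive \<phi>"
    and act_const_term: "\<phi> (act p r) = coeff p 0 * \<phi> r"
begin

definition form :: "complex \<Rightarrow> 'r \<Rightarrow> 'r \<Rightarrow> complex"
  where "form x u v = ev_at \<phi> x (br u v)"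

lemma linear_br:
  "br (u + u') v = br u v + br u' v" "br v (u + u') = br v u + br v u'"
  "br (act [:k:] u) v = map_poly (act [:k:]) (br u v)"
  "br v (act [:k:] u) = map_poly (act [:k:]) (br v u)"
  using bilinear by (auto simp: c_bilinear_def Vector_Spaces.linear_iff)

lemma ev_at_map_act: "ev_at \<phi> x (map_poly (act p) q) = coeff p 0 * ev_at \<phi> x q"
proof -
  have "additive (\<lambda>r. \<phi> (act p r))"
    using additive by (auto simp: act_const_term additive_def algebra_simps)
  hence "ev_at \<phi> x (map_poly (act p) q) = ev_at (\<lambda>r. \<phi> (act p r)) x q"
    using additive by (intro ev_at_map_poly) auto
  thus ?thesis by (simp add: act_const_term ev_at_scale)
qed

lemma form_additive: "additive (\<lambda>u. form x u v)" "additive (form x u)"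
  using additive by (auto simp: additive_def form_def linear_br ev_at_padd)

text \<open>Horner step that extends sesquilinearity, stated only for \<partial>, to every p by
  induction.\<close>

lemma act_pCons: "act (pCons k p) u = act [:k:] u + act [:0, 1:] (act p u)"
proof -
  have "pCons k p = [:k:] + [:0, 1:] * p" by simp
  thus ?thesis by (simp only: scale_left_distrib scale_scale)
qed

lemma form_act_left: "form x (act p u) v = poly p (- x) * form x u v"
proof (induction p)
  case 0
  show ?case using additive.zero[OF form_additive(1)] by simp
next
  case (pCons k p)
  have "form x (act [:0, 1:] (act p u)) v = - x * form x (act p u) v"
    using additive by (simp add: form_def sesquilinear_left ev_at_uminus ev_at_pCons additive.zero del: scale_scale)
  moreover have "form x (act [:k:] u) v = k * form x u v"
    by (simp add: form_def linear_br ev_at_map_act)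
  ultimately show ?case using pCons
    by (subst act_pCons) (simp add: additive.add[OF form_additive(1)] algebra_simps del: scale_scale)
qed

lemma form_act_right: "form x u (act p v) = poly p x * form x u v"
proof (induction p)
  case 0
  show ?case using additive.zero[OF form_additive(2)] by simp
next
  case (pCons k p)
  have "form x u (act [:0, 1:] (act p v)) = x * form x u (act p v)"
    using additive
    by (simp add: form_def sesquilinear_right ev_at_padd ev_at_pCons additive.zero ev_at_map_act
        del: scale_scale)
  moreover have "form x u (act [:k:] v) = k * form x u v"
    by (simp add: form_def linear_br ev_at_map_act)
  ultimately show ?case using pCons
    by (subst act_pCons) (simp add: additive.add[OF form_additive(2)] algebra_simps del: scale_scale)
qed

text \<open>Since \<phi> kills the image of \<partial>, the operator -\<lambda> - \<partial> becomes
  the scalar -x.\<close>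

lemma form_skew: "form x u v = - form (- x) v u"
proof -
  have "ev_at \<phi> x (subst_op (\<lambda>q. - pCons 0 q - map_poly (act [:0, 1:]) q) (\<lambda>r. [:r:]) (br v u)) =
      ev_at (\<lambda>r. ev_at \<phi> x [:r:]) (- x) (br v u)"
    using additive
    by (intro subst_op_eval)
      (simp_all add: ev_at_additive ev_at_pdiff ev_at_uminus ev_at_pCons additive.zero ev_at_map_act)
  thus ?thesis
    using additive skew_symmetry[of u v]
    by (simp add: form_def ev_at_uminus ev_at_pCons ev_at_0)
qed

lemma br_eq_0_commute: "br u v = 0 \<Longrightarrow> br v u = 0"
  using skew_symmetry[of v u] by (simp add: subst_op_def)

lemma form_jacobi:
  "ev_at (form x u) y (br v w) =
    ev_at (\<lambda>r. form (x + y) r w) x (br u v) + ev_at (form y v) x (br u w)"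
  using arg_cong[OF jacobi[of u v w], of "ev_at2 \<phi> x y"] additive
  by (simp add: ev_at_padd ev_at_additive subst_mu subst_lam at_lam at_mu at_lam_mu form_def[abs_def])

end

section \<open>The scalar cocycle of a central extension\<close>

lemma map_poly_inclusion_lam_act:
  assumes "module (ext_act act)"
  shows "map_poly (\<lambda>r. (r, 0)) (lam_act act P z) = lam_act (ext_act act) P (z, 0)"
    and "map_poly (\<lambda>z. (0, z)) q = lam_act (ext_act act) (map_poly (\<lambda>k. [:k:]) q) (0, 1)"
proof -
  interpret module "ext_act act" by fact
  \<comment> \<open>Only the extended action is known to be a module; its first coordinate yields
    these two laws for \<open>act\<close>.\<close>
  have [simp]: "act p 0 = 0" "act 0 r = 0" for p r
    using scale_zero_right[of p] scale_zero_left[of "(r, 0)"]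
    by (simp_all add: ext_act_def zero_prod_def)
  show "map_poly (\<lambda>r. (r, 0)) (lam_act act P z) = lam_act (ext_act act) P (z, 0)"
    unfolding lam_act_def by (rule poly_eqI) (simp add: coeff_map_poly ext_act_def zero_prod_def)
  show "map_poly (\<lambda>z. (0, z)) q = lam_act (ext_act act) (map_poly (\<lambda>k. [:k:]) q) (0, 1)"
    unfolding lam_act_def by (rule poly_eqI) (simp add: coeff_map_poly ext_act_def zero_prod_def)
qed

locale central_cocycle =
  fixes act :: "complex poly \<Rightarrow> 'r::ab_group_add \<Rightarrow> 'r" and br :: "'r \<Rightarrow> 'r \<Rightarrow> 'r poly"
    and br' :: "'r \<times> complex \<Rightarrow> 'r \<times> complex \<Rightarrow> ('r \<times> complex) poly"
    and \<alpha> :: "'r \<Rightarrow> 'r \<Rightarrow> complex poly"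
  assumes lie: "lie_conformal_algebra (ext_act act) br'"
    and central: "br' (0, 1) v = 0"
    and br': "br' (x, 0) (y, 0) = map_poly (\<lambda>r. (r, 0)) (br x y) + map_poly (\<lambda>z. (0, z)) (\<alpha> x y)"
begin

text \<open>The projection to the center kills the image of \<partial> because \<partial>
  annihilates \<open>(0, 1)\<close>.\<close>

sublocale lie_conformal_functional "ext_act act" br' snd
proof -
  interpret lie_conformal_algebra "ext_act act" br' by (rule lie)
  show "lie_conformal_functional (ext_act act) br' snd"
    by unfold_locales (auto simp: ext_act_def)
qed

lemma br'_lam_act:
  assumes "br x y = lam_act act P z"
  shows "br' (x, 0) (y, 0) =
    lam_act (ext_act act) P (z, 0) + lam_act (ext_act act) (map_poly (\<lambda>k. [:k:]) (\<alpha> x y)) (0, 1)"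
  by (simp add: br' assms map_poly_inclusion_lam_act[OF module_axioms])

lemma central_right: "br' v (0, 1) = 0"
  by (rule br_eq_0_commute[OF central])

lemma form_central: "form x (0, 1) v = 0" "form x v (0, 1) = 0"
  by (simp_all add: form_def central central_right ev_at_0 additive)

lemma form_cocycle: "form x (u, 0) (v, 0) = poly (\<alpha> u v) x"
proof -
  have "ev_at snd x (map_poly (\<lambda>r. (r, 0::complex)) p) = 0" for p :: "'r poly"
    using ev_at_map_poly[of snd "\<lambda>r. (r, 0)" x p]
    by (simp add: additive_def zero_prod_def) (simp add: ev_at_def)
  moreover have "ev_at snd x (map_poly (\<lambda>z. (0 :: 'r, z)) q) = poly q x" for q
    using ev_at_map_poly[of snd "\<lambda>z. (0 :: 'r, z)" x q]
    by (simp add: additive_def zero_prod_def) (simp add: ev_at_def poly_altdef)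
  ultimately show ?thesis by (simp add: form_def br' ev_at_padd additive)
qed

lemma cocycle_skew: "poly (\<alpha> u v) x = - poly (\<alpha> v u) (- x)"
  using form_skew[of x "(u, 0)" "(v, 0)"] by (simp add: form_cocycle)

text \<open>The central parts of the inner brackets drop out in the outer ones. In the three
  remaining terms \<partial> becomes x, -(x + y) and y. Inner brackets that are multiples of one
  element suffice, since this is how basis elements of TSV(a,b) multiply.\<close>

lemma cocycle_jacobi:
  assumes vw: "br v w = lam_act act P z" and uv: "br u v = lam_act act P' z'"
    and uw: "br u w = lam_act act P'' z''"
  shows "ev2 x y P * poly (\<alpha> u z) x =
    ev2 (- (x + y)) x P' * poly (\<alpha> z' w) (x + y) + ev2 y x P'' * poly (\<alpha> v z'') y"
proof -
  have r: "ev_at (form s (p, 0)) t (br' (q, 0) (q', 0)) = ev2 s t Q * poly (\<alpha> p h) s"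
    if "br q q' = lam_act act Q h" for s t p q q' Q h
    unfolding br'_lam_act[OF that] ev_at_padd[OF form_additive(2)]
      ev_at_lam_act[OF form_additive(2) form_act_right scale_zero_left]
    by (simp add: form_cocycle form_central)
  have l: "ev_at (\<lambda>r. form s r (p, 0)) t (br' (q, 0) (q', 0)) = ev2 (- s) t Q * poly (\<alpha> h p) s"
    if "br q q' = lam_act act Q h" for s t p q q' Q h
    unfolding br'_lam_act[OF that] ev_at_padd[OF form_additive(1)]
      ev_at_lam_act[OF form_additive(1) form_act_left scale_zero_left]
    by (simp add: form_cocycle form_central)
  show ?thesis
    using form_jacobi[of x "(u, 0)" y "(v, 0)" "(w, 0)"]
    by (simp only: r[OF vw] l[OF uv] r[OF uw])
qed

end

section \<open>The functional equations\<close>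

lemma poly_ext:
  fixes p q :: "'a :: {comm_ring_1, ring_no_zero_divisors, ring_char_0} poly"
  assumes "\<And>x. poly p x = poly q x"
  shows "p = q"
  using assms by (simp add: poly_eq_poly_eq_iff[symmetric] fun_eq_iff)

text \<open>The cocycle equation for \<open>[L\<^sub>\<lambda> v]\<close>, where \<open>[L\<^sub>\<lambda> v] = (\<partial> + c \<lambda> + e) v\<close> modulo the center.\<close>

definition primary_cocycle :: "complex \<Rightarrow> complex \<Rightarrow> complex poly \<Rightarrow> bool"
  where "primary_cocycle c e p \<longleftrightarrow> (\<forall>x y.
    (x + c * y + e) * poly p x = (x - y) * poly p (x + y) + (y + c * x + e) * poly p y)"

lemma primary_cocycle_shift:
  assumes "primary_cocycle c e p"
  shows "e * poly p x = (c * x + e) * poly p 0"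
  using assms[unfolded primary_cocycle_def, rule_format, of x 0] by (simp add: algebra_simps)

text \<open>Comparing the coefficients of \<open>y\<close> and of \<open>y\<^sup>2\<close>, i.e. the first two derivatives at \<open>y = 0\<close>.\<close>

lemma primary_cocycle_derivs:
  assumes "primary_cocycle c 0 p"
  shows "c * poly p x - poly p 0 - c * x * poly (pderiv p) 0 = x * poly (pderiv p) x - poly p x" (is ?A)
    and "2 * poly (pderiv p) x - 2 * poly (pderiv p) 0 = x * poly (pderiv (pderiv p)) x
      + c * x * poly (pderiv (pderiv p)) 0" (is ?B)
proof -
  \<comment> \<open>Difference of the two sides as a polynomial in y, for fixed x.\<close>
  define q where "q = smult (poly p x) [:x, c:] - [:x, -1:] * pcompose p [:x, 1:] - [:c * x, 1:] * p"
  have "poly q y = 0" for y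
    using assms[unfolded primary_cocycle_def, rule_format, of x y]
    by (simp add: q_def poly_pcompose algebra_simps)
  hence "q = 0" using poly_all_0_iff_0 by blast
  hence "poly (pderiv q) 0 = 0" "poly (pderiv (pderiv q)) 0 = 0" by simp_all
  thus ?A ?B
    by (simp_all add: q_def pderiv_diff pderiv_add pderiv_minus pderiv_smult pderiv_mult pderiv_pcompose pderiv_pCons
        poly_pcompose algebra_simps)
qed

text \<open>Write p_n for the coefficients. The first derivative identity gives c p_0 = 0 and (c - n
  + 1) p_n = 0 for n >= 2; the second gives n (n - 3) p_n = 0 for n >= 3. The linear coefficient
  stays free.\<close>

lemma primary_cocycle_coeff:
  assumes "primary_cocycle c 0 p"
  shows "c * coeff p 0 = 0" "(c - 1) * coeff p 2 = 0" "(c - 2) * coeff p 3 = 0"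
    and "n > 3 \<Longrightarrow> coeff p n = 0"
proof -
  let ?k = "poly (pderiv p) 0" and ?l = "poly (pderiv (pderiv p)) 0"
  have "smult c p - [:poly p 0, c * ?k:] = pCons 0 (pderiv p) - p" (is "?lhs = ?rhs")
  proof (rule poly_ext)
    show "poly ?lhs x = poly ?rhs x" for x
      using primary_cocycle_derivs(1)[OF assms, of x] by (simp add: algebra_simps)
  qed
  hence 1: "coeff (smult c p - [:poly p 0, c * ?k:]) n = coeff (pCons 0 (pderiv p) - p) n" for n
    by simp
  have "smult 2 (pderiv p) - [:2 * ?k:] = pCons 0 (pderiv (pderiv p)) + [:0, c * ?l:]" (is "?lhs = ?rhs")
  proof (rule poly_ext)
    show "poly ?lhs x = poly ?rhs x" for x
      using primary_cocycle_derivs(2)[OF assms, of x] by (simp add: algebra_simps)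
  qed
  hence 2: "coeff (smult 2 (pderiv p) - [:2 * ?k:]) n =
      coeff (pCons 0 (pderiv (pderiv p)) + [:0, c * ?l:]) n" for n
    by simp
  show "c * coeff p 0 = 0" using 1[of 0] by (simp add: poly_0_coeff_0)
  show "(c - 1) * coeff p 2 = 0"
    using 1[of 2] by (simp add: coeff_pderiv numeral_2_eq_2) (auto simp: algebra_simps)
  show "(c - 2) * coeff p 3 = 0"
    using 1[of 3] by (simp add: coeff_pderiv numeral_3_eq_3) (auto simp: algebra_simps)
  show "coeff p n = 0" if "n > 3"
  proof -
    \<comment> \<open>Four successors let the coefficient of x^(n - 1) in the second identity reduce
      past all its low-degree terms.\<close>
    define m where "m = n - 4"
    have n: "n = Suc (Suc (Suc (Suc m)))" using that by (simp add: m_def)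
    have "complex_of_nat n * (of_nat n - 3) * coeff p n = 0"
      using 2[of "Suc (Suc (Suc m))"] by (simp add: n coeff_pderiv) (auto simp: algebra_simps)
    moreover have "complex_of_nat n \<noteq> of_nat 0" "complex_of_nat n \<noteq> of_nat 3"
      using that by (simp_all only: of_nat_eq_iff)
    ultimately show ?thesis by simp
  qed
qed

lemma poly_cubic_eqI:
  assumes "\<And>n. n > 3 \<Longrightarrow> coeff p n = 0"
  shows "p = [:coeff p 0, coeff p 1, coeff p 2, coeff p 3:]"
proof (rule poly_eqI)
  fix n :: nat
  have "n = 0 \<or> n = 1 \<or> n = 2 \<or> n = 3 \<or> (\<exists>m. n = Suc (Suc (Suc (Suc m))))" by presburger
  thus "coeff p n = coeff [:coeff p 0, coeff p 1, coeff p 2, coeff p 3:] n"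
    by (elim disjE exE) (simp_all add: assms numeral_2_eq_2 numeral_3_eq_3)
qed

lemma primary_cocycle_cubic:
  assumes "primary_cocycle c 0 p"
  obtains A B C D where "p = [:C, A, D, B:]" "c = 0 \<or> C = 0" "c = 1 \<or> D = 0" "c = 2 \<or> B = 0"
proof (rule that)
  show "p = [:coeff p 0, coeff p 1, coeff p 2, coeff p 3:]"
    by (rule poly_cubic_eqI[OF primary_cocycle_coeff(4)[OF assms]])
qed (use primary_cocycle_coeff(1-3)[OF assms] in auto)

text \<open>Oddness, which skew-symmetry gives for \<alpha>(v,v), removes both even coefficients
  whatever c is.\<close>

lemma primary_cocycle_odd:
  assumes "primary_cocycle c 0 p" "\<And>x. poly p x = - poly p (- x)"
  obtains A B where "p = [:0, A, 0, B:]" "c = 2 \<or> B = 0"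
proof -
  obtain A B C D where p: "p = [:C, A, D, B:]" "c = 2 \<or> B = 0"
    using primary_cocycle_cubic[OF assms(1)] by metis
  moreover have "C = 0" "D = 0" using assms(2)[of 0] assms(2)[of 1] p(1) by (auto simp: algebra_simps)
  ultimately show ?thesis using that by blast
qed

section \<open>Central extensions of \<open>TSV(a,b)\<close>\<close>

locale tsv_cocycle = central_cocycle tsv_act "tsv_bracket a b" br \<alpha> for a b br \<alpha>
begin

text \<open>Zero brackets are written as a zero multiple of a basis element to fit
  \<open>cocycle_jacobi\<close>.\<close>

lemma tsv_bracket_0: "tsv_bracket a b tsv_Y tsv_M = lam_act tsv_act 0 tsv_M"
  "tsv_bracket a b tsv_M tsv_M = lam_act tsv_act 0 tsv_M"
  by (simp_all add: tsv_bracket_basis lam_act_def)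

text \<open>In the Jacobi identity for (L, L, v), the factor x - y is \<partial> + 2\<lambda> at
  \<partial> = -(x + y), \<lambda> = x.\<close>

lemma primary_LL: "primary_cocycle 2 0 (\<alpha> tsv_L tsv_L)"
  and primary_LY: "primary_cocycle a b (\<alpha> tsv_L tsv_Y)"
  and primary_LM: "primary_cocycle (2 * (a - 1)) (2 * b) (\<alpha> tsv_L tsv_M)"
proof -
  have "(x + 2 * y + 0) * poly (\<alpha> tsv_L tsv_L) x =
      (x - y) * poly (\<alpha> tsv_L tsv_L) (x + y) + (y + 2 * x + 0) * poly (\<alpha> tsv_L tsv_L) y" for x y
    using cocycle_jacobi[OF tsv_bracket_basis(1) tsv_bracket_basis(1) tsv_bracket_basis(1), of x y]
    by (simp only: ev2_simps) (simp add: algebra_simps)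
  thus "primary_cocycle 2 0 (\<alpha> tsv_L tsv_L)"
    unfolding primary_cocycle_def by blast
  have "(x + a * y + b) * poly (\<alpha> tsv_L tsv_Y) x =
      (x - y) * poly (\<alpha> tsv_L tsv_Y) (x + y) + (y + a * x + b) * poly (\<alpha> tsv_L tsv_Y) y" for x y
    using cocycle_jacobi[OF tsv_bracket_basis(2) tsv_bracket_basis(1) tsv_bracket_basis(2), of x y]
    by (simp only: ev2_simps) (simp add: algebra_simps)
  thus "primary_cocycle a b (\<alpha> tsv_L tsv_Y)"
    unfolding primary_cocycle_def by blast
  have "(x + (2 * (a - 1)) * y + 2 * b) * poly (\<alpha> tsv_L tsv_M) x =
      (x - y) * poly (\<alpha> tsv_L tsv_M) (x + y) + (y + (2 * (a - 1)) * x + 2 * b) * poly (\<alpha> tsv_L tsv_M) y" for x y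
    using cocycle_jacobi[OF tsv_bracket_basis(3) tsv_bracket_basis(1) tsv_bracket_basis(3), of x y]
    by (simp only: ev2_simps) (simp add: algebra_simps)
  thus "primary_cocycle (2 * (a - 1)) (2 * b) (\<alpha> tsv_L tsv_M)"
    unfolding primary_cocycle_def by blast
qed

lemma jacobi_LYY:
  "(x + 2 * y) * poly (\<alpha> tsv_L tsv_M) x =
    ((a - 1) * x - y + b) * poly (\<alpha> tsv_Y tsv_Y) (x + y) +
    (y + a * x + b) * poly (\<alpha> tsv_Y tsv_Y) y"
  using cocycle_jacobi[OF tsv_bracket_basis(4) tsv_bracket_basis(2) tsv_bracket_basis(2), of x y]
  by (simp only: ev2_simps) (simp add: algebra_simps)

lemma jacobi_LYM:
  "((a - 1) * x - y + b) * poly (\<alpha> tsv_Y tsv_M) (x + y) +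
    (y + 2 * (a - 1) * x + 2 * b) * poly (\<alpha> tsv_Y tsv_M) y = 0"
  using cocycle_jacobi[OF tsv_bracket_0(1) tsv_bracket_basis(2) tsv_bracket_basis(3), of x y]
  by (simp only: ev2_simps) (simp add: ev2_def algebra_simps)

lemma MM: "\<alpha> tsv_M tsv_M = 0"
proof -
  \<comment> \<open>In the identity for (Y, Y, M) both terms containing [Y, M] vanish; at y = 0 the
    factor of the third is x.\<close>
  have "poly ([:0, 1:] * \<alpha> tsv_M tsv_M) x = 0" for x
    using cocycle_jacobi[OF tsv_bracket_0(1) tsv_bracket_basis(4) tsv_bracket_0(1), of x 0]
    by (simp only: ev2_simps) (simp add: ev2_def)
  hence "[:0, 1:] * \<alpha> tsv_M tsv_M = 0" using poly_all_0_iff_0 by blast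
  thus ?thesis by simp
qed

section \<open>Solving for the cocycle on the basis\<close>

lemma LL: obtains A B where "\<alpha> tsv_L tsv_L = [:0, A, 0, B:]"
  using primary_cocycle_odd[OF primary_LL cocycle_skew] by blast

lemma LM_YY: "[:0, 1:] * \<alpha> tsv_L tsv_M = [:b, a - 1:] * \<alpha> tsv_Y tsv_Y"
proof (rule poly_ext)
  \<comment> \<open>This removes the last term of \<open>jacobi_LYY\<close> at y = 0.\<close>
  have "poly (\<alpha> tsv_Y tsv_Y) 0 = 0" using cocycle_skew[of tsv_Y tsv_Y 0] by simp
  thus "poly ([:0, 1:] * \<alpha> tsv_L tsv_M) x = poly ([:b, a - 1:] * \<alpha> tsv_Y tsv_Y) x" for x
    using jacobi_LYY[of x 0] by (simp add: algebra_simps)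
qed

lemma LM_YY_b0: "b = 0 \<Longrightarrow> \<alpha> tsv_L tsv_M = smult (a - 1) (\<alpha> tsv_Y tsv_Y)"
  using LM_YY by simp

lemma LY_generic:
  assumes "a \<noteq> 1 \<and> a \<noteq> 2 \<or> b \<noteq> 0"
  obtains C D where "\<alpha> tsv_L tsv_Y = [:C, D:]" "a * C = b * D"
proof (cases "b = 0")
  case True
  obtain A B C D where p: "\<alpha> tsv_L tsv_Y = [:C, A, D, B:]" "a = 0 \<or> C = 0" "a = 1 \<or> D = 0" "a = 2 \<or> B = 0"
    using primary_cocycle_cubic primary_LY unfolding True .
  \<comment> \<open>For b = 0 the constraint is a C = 0, which is the alternative a = 0 or C =
    0.\<close>
  hence "\<alpha> tsv_L tsv_Y = [:C, A:]" "a * C = b * A" using assms True by auto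
  thus ?thesis by (rule that)
next
  case False
  let ?p = "\<alpha> tsv_L tsv_Y"
  have "poly ?p x = poly [:poly ?p 0, a * poly ?p 0 / b:] x" for x
    using primary_cocycle_shift[OF primary_LY, of x] False by (simp add: field_simps)
  hence "?p = [:poly ?p 0, a * poly ?p 0 / b:]" by (rule poly_ext)
  thus ?thesis by (rule that) (use False in simp)
qed

text \<open>For b = 0, \<alpha>(L,M) is a multiple of \<alpha>(Y,Y), hence odd, and a cubic term
  would force 2(a - 1) = 2, the excluded a = 2. For b nonzero, \<alpha>(L,M) is fixed by its
  constant term, and \<open>LM_YY\<close> gives \<alpha>(Y,Y) after cancelling (a - 1)x + b.\<close>

lemma YY_LM_generic:
  assumes "a \<noteq> 1 \<and> a \<noteq> 2 \<or> b \<noteq> 0"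
  obtains E where "\<alpha> tsv_Y tsv_Y = [:0, E:]" "\<alpha> tsv_L tsv_M = [:b * E, (a - 1) * E:]"
proof (cases "b = 0")
  case True
  hence a: "a \<noteq> 1" "a \<noteq> 2" using assms by auto
  note LM = LM_YY_b0[OF True]
  have "poly (\<alpha> tsv_L tsv_M) x = - poly (\<alpha> tsv_L tsv_M) (- x)" for x
    using cocycle_skew[of tsv_Y tsv_Y x] by (simp add: LM)
  moreover have "primary_cocycle (2 * (a - 1)) 0 (\<alpha> tsv_L tsv_M)"
    using primary_LM unfolding True mult_zero_right .
  ultimately obtain A B where "\<alpha> tsv_L tsv_M = [:0, A, 0, B:]" "2 * (a - 1) = 2 \<or> B = 0"
    using primary_cocycle_odd by blast
  hence A: "\<alpha> tsv_L tsv_M = [:0, A:]" using a by auto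
  have "\<alpha> tsv_Y tsv_Y = smult (1 / (a - 1)) (\<alpha> tsv_L tsv_M)" using a by (simp add: LM)
  thus ?thesis using that[of "A / (a - 1)"] A a True by simp
next
  case False
  let ?p = "\<alpha> tsv_L tsv_M"
  \<comment> \<open>Normalised so that the constant term of \<alpha>(L,M) is b E.\<close>
  define E where "E = poly ?p 0 / b"
  have "poly ?p x = poly [:b * E, (a - 1) * E:] x" for x
  proof -
    have "2 * (b * poly ?p x - ((a - 1) * x + b) * poly ?p 0) = 0"
      using primary_cocycle_shift[OF primary_LM, of x] by (simp add: algebra_simps)
    hence "b * poly ?p x = ((a - 1) * x + b) * poly ?p 0" by (simp only: mult_eq_0_iff) simp
    thus ?thesis using False by (simp add: field_simps E_def)
  qed
  hence p: "?p = [:b * E, (a - 1) * E:]" by (rule poly_ext)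
  have "[:b, a - 1:] * \<alpha> tsv_Y tsv_Y = [:0, 1:] * [:b * E, (a - 1) * E:]"
    by (simp only: LM_YY[symmetric] p)
  also have "\<dots> = [:b, a - 1:] * [:0, E:]" by (simp add: mult.commute)
  finally have "\<alpha> tsv_Y tsv_Y = [:0, E:]"
    using False by (subst (asm) mult_cancel_left) auto
  thus ?thesis using that p by blast
qed

text \<open>At y = 0, \<open>jacobi_LYM\<close> factors as ((a - 1)x + b)(p(x) + 2 p(0)) = 0. So p
  is the constant -2 p(0), and 3 p(0) = 0.\<close>

lemma YM_generic:
  assumes "a \<noteq> 1 \<or> b \<noteq> 0"
  shows "\<alpha> tsv_Y tsv_M = 0"
proof -
  let ?p = "\<alpha> tsv_Y tsv_M"
  have "poly ([:b, a - 1:] * (?p + [:2 * poly ?p 0:])) x = 0" for x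
    using jacobi_LYM[of x 0] by (simp add: algebra_simps)
  hence "[:b, a - 1:] * (?p + [:2 * poly ?p 0:]) = 0" using poly_all_0_iff_0 by blast
  moreover have "[:b, a - 1:] \<noteq> 0" using assms by auto
  ultimately have *: "?p + [:2 * poly ?p 0:] = 0" by (simp only: mult_eq_0_iff) simp
  from arg_cong[OF this, of "\<lambda>q. poly q 0"] have "poly ?p 0 = 0" by simp
  with * show ?thesis by simp
qed

section \<open>From the cocycle to the table of brackets\<close>

lemma br_basis:
  "br \<L> \<L> = (\<partial> + 2 * lam) \<odot> \<L> + map_poly (\<lambda>k. [:k:]) (\<alpha> tsv_L tsv_L) \<odot> \<cc>"
  "br \<L> \<Y> = (\<partial> + cst a * lam + cst b) \<odot> \<Y> + map_poly (\<lambda>k. [:k:]) (\<alpha> tsv_L tsv_Y) \<odot> \<cc>"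
  "br \<L> \<M> = (\<partial> + cst (2 * (a - 1)) * lam + cst (2 * b)) \<odot> \<M>
    + map_poly (\<lambda>k. [:k:]) (\<alpha> tsv_L tsv_M) \<odot> \<cc>"
  "br \<Y> \<Y> = (\<partial> + 2 * lam) \<odot> \<M> + map_poly (\<lambda>k. [:k:]) (\<alpha> tsv_Y tsv_Y) \<odot> \<cc>"
  "br \<Y> \<M> = map_poly (\<lambda>k. [:k:]) (\<alpha> tsv_Y tsv_M) \<odot> \<cc>"
  "br \<M> \<M> = 0"
  using br'_lam_act[OF tsv_bracket_basis(1)] br'_lam_act[OF tsv_bracket_basis(2)]
    br'_lam_act[OF tsv_bracket_basis(3)] br'_lam_act[OF tsv_bracket_basis(4)]
    br'_lam_act[OF tsv_bracket_0(1)] br'_lam_act[OF tsv_bracket_0(2)]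
  by (simp_all only: MM) (simp_all add: lam_act_def)

lemma basis_distinct:
  "tsv_L \<noteq> tsv_M" "tsv_L \<noteq> tsv_Y" "tsv_M \<noteq> tsv_Y" "tsv_M \<noteq> tsv_L" "tsv_Y \<noteq> tsv_L" "tsv_Y \<noteq> tsv_M"
  by (simp_all add: tsv_L_def tsv_M_def tsv_Y_def)

text \<open>Serves the generic case and a = 2, whose tables omit the pair Y, M; the table for a = 1
  lists it.\<close>

lemma nontrivial_brackets_YM_zero:
  assumes "br \<L> \<L> = p" "br \<L> \<Y> = q" "br \<Y> \<Y> = r" "br \<L> \<M> = s" "\<alpha> tsv_Y tsv_M = 0"
  shows "nontrivial_brackets br {\<L>, \<Y>, \<M>, \<cc>} {(\<L>, \<L>, p), (\<L>, \<Y>, q), (\<Y>, \<Y>, r), (\<L>, \<M>, s)}"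
proof -
  have YM: "br \<Y> \<M> = 0" using assms(5) br_basis(5) by (simp add: lam_act_def)
  show ?thesis
    unfolding nontrivial_brackets_def using assms(1-4)
    by (simp add: basis_distinct central central_right YM br_eq_0_commute[OF YM] br_basis(6))
qed

lemma nontrivial_brackets_YM:
  assumes "br \<L> \<L> = p" "br \<L> \<Y> = q" "br \<L> \<M> = s" "br \<Y> \<Y> = r" "br \<Y> \<M> = t"
  shows "nontrivial_brackets br {\<L>, \<Y>, \<M>, \<cc>}
    {(\<L>, \<L>, p), (\<L>, \<Y>, q), (\<L>, \<M>, s), (\<Y>, \<Y>, r), (\<Y>, \<M>, t)}"
  unfolding nontrivial_brackets_def using assms
  by (simp add: basis_distinct central central_right br_basis(6))

end

lemma central_extension_tsvE:
  assumes "central_extension tsv_act (tsv_bracket a b) br"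
  obtains \<alpha> where "tsv_cocycle a b br \<alpha>"
  using assms unfolding central_extension_def tsv_cocycle_def central_cocycle_def by blast

lemma map_poly_const_pCons: "map_poly (\<lambda>k. [:k:]) [:A:] = cst A"
  "map_poly (\<lambda>k. [:k:]) [:A, B:] = cst A + cst B * lam"
  "map_poly (\<lambda>k. [:k:]) [:0, B, C:] = cst B * lam + cst C * lam ^ 2"
  "map_poly (\<lambda>k. [:k:]) [:0, B, 0, D:] = cst B * lam + cst D * lam ^ 3"
  by (simp_all add: map_poly_pCons power2_eq_square power3_eq_cube)

section \<open>The three cases\<close>

lemma tsv_generic:
  assumes "central_extension tsv_act (tsv_bracket a b) br" and "a \<noteq> 1 \<and> a \<noteq> 2 \<or> b \<noteq> 0"
  shows "\<exists>A B C D E. a * C = b * D \<and>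
    nontrivial_brackets br {\<L>, \<Y>, \<M>, \<cc>}
     {(\<L>, \<L>, (\<partial> + 2 * lam) \<odot> \<L> + (cst A * lam + cst B * lam ^ 3) \<odot> \<cc>),
      (\<L>, \<Y>, (\<partial> + cst a * lam + cst b) \<odot> \<Y> + (cst C + cst D * lam) \<odot> \<cc>),
      (\<Y>, \<Y>, (\<partial> + 2 * lam) \<odot> \<M> + (cst E * lam) \<odot> \<cc>),
      (\<L>, \<M>, (\<partial> + cst (2 * (a - 1)) * lam + cst (2 * b)) \<odot> \<M>
                + (cst (b * E) + cst ((a - 1) * E) * lam) \<odot> \<cc>)}"
proof -
  obtain \<alpha> where "tsv_cocycle a b br \<alpha>" using assms(1) by (rule central_extension_tsvE)
  then interpret tsv_cocycle a b br \<alpha> .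
  obtain A B where LL: "\<alpha> tsv_L tsv_L = [:0, A, 0, B:]" by (rule LL)
  obtain C D where LY: "\<alpha> tsv_L tsv_Y = [:C, D:]" and CD: "a * C = b * D"
    using assms(2) by (rule LY_generic)
  obtain E where E: "\<alpha> tsv_Y tsv_Y = [:0, E:]" "\<alpha> tsv_L tsv_M = [:b * E, (a - 1) * E:]"
    using assms(2) by (rule YY_LM_generic)
  have "\<alpha> tsv_Y tsv_M = 0" using assms(2) by (intro YM_generic) auto
  with CD show ?thesis
    by (intro exI conjI nontrivial_brackets_YM_zero)
      (simp_all only: br_basis LL LY E map_poly_const_pCons pCons_0_0 add_0_left)
qed

lemma tsv_2_0:
  assumes "central_extension tsv_act (tsv_bracket 2 0) br"
  shows "\<exists>A B C D E F. nontrivial_brackets br {\<L>, \<Y>, \<M>, \<cc>}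
     {(\<L>, \<L>, (\<partial> + 2 * lam) \<odot> \<L> + (cst A * lam + cst B * lam ^ 3) \<odot> \<cc>),
      (\<L>, \<Y>, (\<partial> + 2 * lam) \<odot> \<Y> + (cst C * lam + cst D * lam ^ 3) \<odot> \<cc>),
      (\<Y>, \<Y>, (\<partial> + 2 * lam) \<odot> \<M> + (cst E * lam + cst F * lam ^ 3) \<odot> \<cc>),
      (\<L>, \<M>, (\<partial> + 2 * lam) \<odot> \<M> + (cst E * lam + cst F * lam ^ 3) \<odot> \<cc>)}"
proof -
  obtain \<alpha> where "tsv_cocycle 2 0 br \<alpha>" using assms by (rule central_extension_tsvE)
  then interpret tsv_cocycle 2 0 br \<alpha> .
  obtain A B where LL: "\<alpha> tsv_L tsv_L = [:0, A, 0, B:]" by (rule LL)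
  obtain C D c\<^sub>0 c\<^sub>2 where "\<alpha> tsv_L tsv_Y = [:c\<^sub>0, C, c\<^sub>2, D:]"
    "(2 :: complex) = 0 \<or> c\<^sub>0 = 0" "(2 :: complex) = 1 \<or> c\<^sub>2 = 0" "(2 :: complex) = 2 \<or> D = 0"
    by (rule primary_cocycle_cubic[OF primary_LY])
  hence LY: "\<alpha> tsv_L tsv_Y = [:0, C, 0, D:]" by simp
  \<comment> \<open>As a - 1 = 1, the two cocycles coincide: the functional equation comes from (L,
    M), the oddness from (Y, Y).\<close>
  have LM: "\<alpha> tsv_L tsv_M = \<alpha> tsv_Y tsv_Y" using LM_YY_b0 by simp
  hence "primary_cocycle 2 0 (\<alpha> tsv_Y tsv_Y)" using primary_LM by simp
  then obtain E F where E: "\<alpha> tsv_Y tsv_Y = [:0, E, 0, F:]"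
    by (rule primary_cocycle_odd) (rule cocycle_skew, blast)
  have coeffs: "\<partial> + cst 2 * lam + cst 0 = \<partial> + 2 * lam"
    "\<partial> + cst (2 * (2 - 1)) * lam + cst (2 * 0) = \<partial> + 2 * lam"
    by (simp_all add: numeral_poly)
  have "\<alpha> tsv_Y tsv_M = 0" by (rule YM_generic) simp
  thus ?thesis
    by (intro exI nontrivial_brackets_YM_zero)
      (simp_all only: br_basis coeffs LL LY LM E map_poly_const_pCons)
qed

lemma tsv_1_0:
  assumes "central_extension tsv_act (tsv_bracket 1 0) br"
  shows "\<exists>A B C D E F. nontrivial_brackets br {\<L>, \<Y>, \<M>, \<cc>}
     {(\<L>, \<L>, (\<partial> + 2 * lam) \<odot> \<L> + (cst A * lam + cst B * lam ^ 3) \<odot> \<cc>),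
      (\<L>, \<Y>, (\<partial> + lam) \<odot> \<Y> + (cst C * lam + cst D * lam ^ 2) \<odot> \<cc>),
      (\<L>, \<M>, \<partial> \<odot> \<M>),
      (\<Y>, \<Y>, (\<partial> + 2 * lam) \<odot> \<M> + (cst E * lam) \<odot> \<cc>),
      (\<Y>, \<M>, cst F \<odot> \<cc>)}"
proof -
  obtain \<alpha> where "tsv_cocycle 1 0 br \<alpha>" using assms by (rule central_extension_tsvE)
  then interpret tsv_cocycle 1 0 br \<alpha> .
  obtain A B where LL: "\<alpha> tsv_L tsv_L = [:0, A, 0, B:]" by (rule LL)
  obtain C c\<^sub>3 c\<^sub>0 D where "\<alpha> tsv_L tsv_Y = [:c\<^sub>0, C, D, c\<^sub>3:]"
    "(1 :: complex) = 0 \<or> c\<^sub>0 = 0" "(1 :: complex) = 1 \<or> D = 0" "(1 :: complex) = 2 \<or> c\<^sub>3 = 0"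
    by (rule primary_cocycle_cubic[OF primary_LY])
  \<comment> \<open>The value a = 1 admits the quadratic term and excludes the constant and cubic
    ones.\<close>
  hence LY: "\<alpha> tsv_L tsv_Y = [:0, C, D:]" by simp
  have LM: "\<alpha> tsv_L tsv_M = 0" using LM_YY_b0 by simp
  \<comment> \<open>Here (a - 1)x + b is zero, so y = 0 no longer determines these cocycles. With y
    = 1 and x - 1 for x, \<open>jacobi_LYY\<close> reads p(x) = x p(1) and \<open>jacobi_LYM\<close>
    reads p(x) = p(1).\<close>
  let ?E = "poly (\<alpha> tsv_Y tsv_Y) 1" and ?F = "poly (\<alpha> tsv_Y tsv_M) 1"
  have YY: "\<alpha> tsv_Y tsv_Y = [:0, ?E:]"
  proof (rule poly_ext)
    show "poly (\<alpha> tsv_Y tsv_Y) x = poly [:0, ?E:] x" for x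
      using jacobi_LYY[of "x - 1" 1] by (simp add: LM algebra_simps)
  qed
  have YM: "\<alpha> tsv_Y tsv_M = [:?F:]"
  proof (rule poly_ext)
    show "poly (\<alpha> tsv_Y tsv_M) x = poly [:?F:] x" for x
      using jacobi_LYM[of "x - 1" 1] by (simp add: algebra_simps)
  qed
  have coeffs: "\<partial> + cst 1 * lam + cst 0 = \<partial> + lam"
    "\<partial> + cst (2 * (1 - 1)) * lam + cst (2 * 0) = \<partial>"
    by simp_all
  have "br \<L> \<M> = \<partial> \<odot> \<M>"
    unfolding br_basis coeffs LM by (simp add: lam_act_def)
  moreover have "br \<Y> \<Y> = (\<partial> + 2 * lam) \<odot> \<M> + (cst ?E * lam) \<odot> \<cc>"
    unfolding br_basis by (subst YY) (simp only: map_poly_const_pCons pCons_0_0 add_0_left)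
  moreover have "br \<Y> \<M> = cst ?F \<odot> \<cc>"
    unfolding br_basis by (subst YM) (simp only: map_poly_const_pCons)
  ultimately show ?thesis
    by (intro exI nontrivial_brackets_YM)
      (simp_all only: br_basis(1,2) coeffs LL LY map_poly_const_pCons)
qed

theorem theorem4p2:
  fixes a b :: complex
  shows
   "((a \<noteq> 1 \<and> a \<noteq> 2 \<or> b \<noteq> 0) \<longrightarrow>
      (\<forall>br. central_extension tsv_act (tsv_bracket a b) br \<longrightarrow>
        (\<exists>A B C D E. a * C = b * D \<and>
          nontrivial_brackets br {\<L>, \<Y>, \<M>, \<cc>}
           {(\<L>, \<L>, (\<partial> + 2 * lam) \<odot> \<L> + (cst A * lam + cst B * lam ^ 3) \<odot> \<cc>),
            (\<L>, \<Y>, (\<partial> + cst a * lam + cst b) \<odot> \<Y> + (cst C + cst D * lam) \<odot> \<cc>),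
            (\<Y>, \<Y>, (\<partial> + 2 * lam) \<odot> \<M> + (cst E * lam) \<odot> \<cc>),
            (\<L>, \<M>, (\<partial> + cst (2 * (a - 1)) * lam + cst (2 * b)) \<odot> \<M>
                      + (cst (b * E) + cst ((a - 1) * E) * lam) \<odot> \<cc>)}))) \<and>
    (a = 2 \<and> b = 0 \<longrightarrow>
      (\<forall>br. central_extension tsv_act (tsv_bracket 2 0) br \<longrightarrow>
        (\<exists>A B C D E F.
          nontrivial_brackets br {\<L>, \<Y>, \<M>, \<cc>}
           {(\<L>, \<L>, (\<partial> + 2 * lam) \<odot> \<L> + (cst A * lam + cst B * lam ^ 3) \<odot> \<cc>),
            (\<L>, \<Y>, (\<partial> + 2 * lam) \<odot> \<Y> + (cst C * lam + cst D * lam ^ 3) \<odot> \<cc>),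
            (\<Y>, \<Y>, (\<partial> + 2 * lam) \<odot> \<M> + (cst E * lam + cst F * lam ^ 3) \<odot> \<cc>),
            (\<L>, \<M>, (\<partial> + 2 * lam) \<odot> \<M> + (cst E * lam + cst F * lam ^ 3) \<odot> \<cc>)}))) \<and>
    (a = 1 \<and> b = 0 \<longrightarrow>
      (\<forall>br. central_extension tsv_act (tsv_bracket 1 0) br \<longrightarrow>
        (\<exists>A B C D E F.
          nontrivial_brackets br {\<L>, \<Y>, \<M>, \<cc>}
           {(\<L>, \<L>, (\<partial> + 2 * lam) \<odot> \<L> + (cst A * lam + cst B * lam ^ 3) \<odot> \<cc>),
            (\<L>, \<Y>, (\<partial> + lam) \<odot> \<Y> + (cst C * lam + cst D * lam ^ 2) \<odot> \<cc>),
            (\<L>, \<M>, \<partial> \<odot> \<M>),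
            (\<Y>, \<Y>, (\<partial> + 2 * lam) \<odot> \<M> + (cst E * lam) \<odot> \<cc>),
            (\<Y>, \<M>, cst F \<odot> \<cc>)})))"
  using tsv_generic tsv_2_0 tsv_1_0 by (intro conjI impI allI) simp_all

end
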